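(* Let $(P_1\oplus P_2,\odot,\{\!\!\{~,~\}\!\!\})$ be a proto-twilled Poisson algebra over a field $\mathbf{k}$ of characteristic $0$, with structure maps $\cdot_1,\cdot_2,\mu,\nu,h,\theta,\{~,~\}_1,\{~,~\}_2,\rho,\psi,H,\Theta$, and let $r:P_2\to P_1$ be a deformation map on it. Define maps $\nu_r,\psi_r:P_2\to\mathrm{End}(P_1)$ by $$(\nu_r)_ux:=\nu_ux+r(u)\cdot_1x-r\big(\mu_xu+h(r(u),x)\big),$$ $$(\psi_r)_ux:=\psi_ux+\{r(u),x\}_1-r\big(-\rho_xu+H(r(u),x)\big),$$ for $u\in P_2$ and $x\in P_1$. Then the triple $(P_1,\nu_r,\psi_r)$ is a representation of the induced Poisson algebra $(P_2)_r=(P_2,\cdot_r,\{~,~\}_r)$.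
   Context: A Poisson algebra is a vector space with a commutative associative product and a Lie bracket such that the bracket satisfies the Leibniz rule $\{x,yz\}=\{x,y\}z+y\{x,z\}$. A representation $(V,\mu,\rho)$ of a Poisson algebra $(P,\cdot,\{~,~\})$ is a vector space $V$ with linear maps $\mu,\rho:P\to\mathrm{End}(V)$ such that for all $x,y\in P$: $\mu_{x\cdot y}=\mu_x\mu_y$, $\rho_{\{x,y\}}=\rho_x\rho_y-\rho_y\rho_x$, $\mu_{\{x,y\}}=\rho_x\mu_y-\mu_y\rho_x$, $\rho_{x\cdot y}=\mu_x\rho_y+\mu_y\rho_x$. A proto-twilled Poisson algebra is a Poisson algebra $(\mathcal{P},\odot,\{\!\!\{~,~\}\!\!\})$ whose underlying vector space has a direct sum decomposition $\mathcal{P}=P_1\oplus P_2$ into subspaces (not necessarily subalgebras). Its structure maps are the (bi)linear maps $\cdot_1:P_1\times P_1\to P_1$, $\cdot_2:P_2\times P_2\to P_2$, $h:P_1\times P_1\to P_2$, $\theta:P_2\times P_2\to P_1$ (symmetric), $\{~,~\}_1:P_1\times P_1\to P_1$, $\{~,~\}_2:P_2\times P_2\to P_2$, $H:P_1\times P_1\to P_2$, $\Theta:P_2\times P_2\to P_1$ (antisymmetric), $\mu,\rho:P_1\to\mathrm{End}(P_2)$, $\nu,\psi:P_2\to\mathrm{End}(P_1)$ uniquely determined by $$(x,u)\odot(y,v)=\big(x\cdot_1y+\nu_uy+\nu_vx+\theta(u,v),\ u\cdot_2v+\mu_xv+\mu_yu+h(x,y)\big),$$ $$\{\!\!\{(x,u),(y,v)\}\!\!\}=\big(\{x,y\}_1+\psi_uy-\psi_vx+\Theta(u,v),\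 \{u,v\}_2+\rho_xv-\rho_yu+H(x,y)\big).$$ A linear map $r:P_2\to P_1$ is a deformation map if its graph $Gr(r)=\{(r(u),u)\mid u\in P_2\}$ is a Poisson subalgebra of $\mathcal{P}$ (closed under $\odot$ and $\{\!\!\{~,~\}\!\!\}$). The induced Poisson algebra $(P_2)_r=(P_2,\cdot_r,\{~,~\}_r)$ is the vector space $P_2$ with $u\cdot_rv=u\cdot_2v+\mu_{r(u)}v+\mu_{r(v)}u+h(r(u),r(v))$ and $\{u,v\}_r=\{u,v\}_2+\rho_{r(u)}v-\rho_{r(v)}u+H(r(u),r(v))$. *)

theory Defs
  imports "HOL-Analysis.Product_Vector"
begin

definition bilinear_map ::
    "('k::field \<Rightarrow> 'a::ab_group_add \<Rightarrow> 'a) \<Rightarrow> ('k \<Rightarrow> 'b::ab_group_add \<Rightarrow> 'b)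
      \<Rightarrow> ('k \<Rightarrow> 'c::ab_group_add \<Rightarrow> 'c) \<Rightarrow> ('a \<Rightarrow> 'b \<Rightarrow> 'c) \<Rightarrow> bool" where
  "bilinear_map s1 s2 s3 f \<longleftrightarrow>
     (\<forall>x. Vector_Spaces.linear s2 s3 (f x)) \<and> (\<forall>y. Vector_Spaces.linear s1 s3 (\<lambda>x. f x y))"

locale poisson_algebra = vector_space s
  for s :: "'k::field \<Rightarrow> 'p::ab_group_add \<Rightarrow> 'p" +
  fixes mult :: "'p \<Rightarrow> 'p \<Rightarrow> 'p"
    and bracket :: "'p \<Rightarrow> 'p \<Rightarrow> 'p"
  assumes mult_bilinear: "bilinear_map s s s mult"
    and mult_commute: "mult x y = mult y x"
    and mult_assoc: "mult (mult x y) z = mult x (mult y z)"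
    and bracket_bilinear: "bilinear_map s s s bracket"
    and bracket_self: "bracket x x = 0"
    and jacobi: "bracket x (bracket y z) + bracket y (bracket z x) + bracket z (bracket x y) = 0"
    and leibniz: "bracket x (mult y z) = mult (bracket x y) z + mult y (bracket x z)"

definition poisson_subalgebra ::
    "('k::field \<Rightarrow> 'p::ab_group_add \<Rightarrow> 'p) \<Rightarrow> ('p \<Rightarrow> 'p \<Rightarrow> 'p) \<Rightarrow> ('p \<Rightarrow> 'p \<Rightarrow> 'p) \<Rightarrow> 'p set \<Rightarrow> bool" where
  "poisson_subalgebra s mult bracket S \<longleftrightarrow>
     module.subspace s S \<and>
     (\<forall>x\<in>S. \<forall>y\<in>S. mult x y \<in> S) \<and> (\<forall>x\<in>S. \<forall>y\<in>S. bracket x y \<in> S)"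

text \<open>
  A linear map \<open>P \<rightarrow> End V\<close> is encoded as a function of two arguments that is linear in each.
\<close>

locale poisson_representation =
  poisson_algebra scaleP mult bracket + V: vector_space scaleV
  for scaleP :: "'k::field \<Rightarrow> 'p::ab_group_add \<Rightarrow> 'p"
    and mult bracket :: "'p \<Rightarrow> 'p \<Rightarrow> 'p"
    and scaleV :: "'k \<Rightarrow> 'v::ab_group_add \<Rightarrow> 'v" +
  fixes \<mu> \<rho> :: "'p \<Rightarrow> 'v \<Rightarrow> 'v"
  assumes mu_linear: "bilinear_map scaleP scaleV scaleV \<mu>"
    and rho_linear: "bilinear_map scaleP scaleV scaleV \<rho>"
    and mu_mult: "\<mu> (mult x y) v = \<mu> x (\<mu> y v)"
    and rho_bracket: "\<rho> (bracket x y) v = \<rho> x (\<rho> y v) - \<rho> y (\<rho> x v)"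
    and mu_bracket: "\<mu> (bracket x y) v = \<rho> x (\<mu> y v) - \<mu> y (\<rho> x v)"
    and rho_mult: "\<rho> (mult x y) v = \<mu> x (\<rho> y v) + \<mu> y (\<rho> x v)"

text \<open>
  The two summands are the vector spaces on the types \<open>'a\<close> (for \<open>P\<^sub>1\<close>) and \<open>'b\<close> (for \<open>P\<^sub>2\<close>), and the
  decomposed space is their direct sum on the type \<open>'a \<times> 'b\<close>. Nothing is assumed
  about how the operations interact with the decomposition.
\<close>

locale proto_twilled_poisson_algebra =
  vector_space_prod s1 s2 + P: poisson_algebra "module_prod.scale s1 s2" odot brac
  for s1 :: "'k::field \<Rightarrow> 'a::ab_group_add \<Rightarrow> 'a"
    and s2 :: "'k \<Rightarrow> 'b::ab_group_add \<Rightarrow> 'b"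
    and odot brac :: "'a \<times> 'b \<Rightarrow> 'a \<times> 'b \<Rightarrow> 'a \<times> 'b"

locale proto_twilled_structure_maps =
  proto_twilled_poisson_algebra s1 s2 odot brac
  for s1 :: "'k::field \<Rightarrow> 'a::ab_group_add \<Rightarrow> 'a"
    and s2 :: "'k \<Rightarrow> 'b::ab_group_add \<Rightarrow> 'b"
    and odot brac :: "'a \<times> 'b \<Rightarrow> 'a \<times> 'b \<Rightarrow> 'a \<times> 'b" +
  fixes mult1 :: "'a \<Rightarrow> 'a \<Rightarrow> 'a" and mult2 :: "'b \<Rightarrow> 'b \<Rightarrow> 'b"
    and \<mu> :: "'a \<Rightarrow> 'b \<Rightarrow> 'b" and \<nu> :: "'b \<Rightarrow> 'a \<Rightarrow> 'a"
    and h :: "'a \<Rightarrow> 'a \<Rightarrow> 'b" and \<theta> :: "'b \<Rightarrow> 'b \<Rightarrow> 'a"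
    and brac1 :: "'a \<Rightarrow> 'a \<Rightarrow> 'a" and brac2 :: "'b \<Rightarrow> 'b \<Rightarrow> 'b"
    and \<rho> :: "'a \<Rightarrow> 'b \<Rightarrow> 'b" and \<psi> :: "'b \<Rightarrow> 'a \<Rightarrow> 'a"
    and H :: "'a \<Rightarrow> 'a \<Rightarrow> 'b" and \<Theta> :: "'b \<Rightarrow> 'b \<Rightarrow> 'a"
  assumes mult1_bilinear: "bilinear_map s1 s1 s1 mult1" and mult1_sym: "mult1 x y = mult1 y x"
    and mult2_bilinear: "bilinear_map s2 s2 s2 mult2" and mult2_sym: "mult2 u v = mult2 v u"
    and mu_bilinear: "bilinear_map s1 s2 s2 \<mu>"
    and nu_bilinear: "bilinear_map s2 s1 s1 \<nu>"
    and h_bilinear: "bilinear_map s1 s1 s2 h" and h_sym: "h x y = h y x"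
    and theta_bilinear: "bilinear_map s2 s2 s1 \<theta>" and theta_sym: "\<theta> u v = \<theta> v u"
    and brac1_bilinear: "bilinear_map s1 s1 s1 brac1" and brac1_antisym: "brac1 x y = - brac1 y x"
    and brac2_bilinear: "bilinear_map s2 s2 s2 brac2" and brac2_antisym: "brac2 u v = - brac2 v u"
    and rho_bilinear: "bilinear_map s1 s2 s2 \<rho>"
    and psi_bilinear: "bilinear_map s2 s1 s1 \<psi>"
    and H_bilinear: "bilinear_map s1 s1 s2 H" and H_antisym: "H x y = - H y x"
    and Theta_bilinear: "bilinear_map s2 s2 s1 \<Theta>" and Theta_antisym: "\<Theta> u v = - \<Theta> v u"
    and odot_eq: "odot (x, u) (y, v) =
      (mult1 x y + \<nu> u y + \<nu> v x + \<theta> u v, mult2 u v + \<mu> x v + \<mu> y u + h x y)"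
    and brac_eq: "brac (x, u) (y, v) =
      (brac1 x y + \<psi> u y - \<psi> v x + \<Theta> u v, brac2 u v + \<rho> x v - \<rho> y u + H x y)"

text \<open>
  Structure maps exist for every proto-twilled Poisson algebra and are unique, so assuming
  \<open>proto_twilled_structure_maps\<close> only names them.
\<close>

lemma (in proto_twilled_structure_maps) structure_maps_unique:
  "mult1 x y = fst (odot (x, 0) (y, 0))" "h x y = snd (odot (x, 0) (y, 0))"
  "mult2 u v = snd (odot (0, u) (0, v))" "\<theta> u v = fst (odot (0, u) (0, v))"
  "\<nu> u y = fst (odot (0, u) (y, 0))" "\<mu> x v = snd (odot (x, 0) (0, v))"
  "brac1 x y = fst (brac (x, 0) (y, 0))" "H x y = snd (brac (x, 0) (y, 0))"
  "brac2 u v = snd (brac (0, u) (0, v))" "\<Theta> u v = fst (brac (0, u) (0, v))"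
  "\<psi> u y = fst (brac (0, u) (y, 0))" "\<rho> x v = snd (brac (x, 0) (0, v))"
proof -
  have z: "f a 0 = 0" "f 0 b = 0" if "bilinear_map sa sb sc f"
    for sa :: "'k \<Rightarrow> 'x::ab_group_add \<Rightarrow> 'x" and sb :: "'k \<Rightarrow> 'y::ab_group_add \<Rightarrow> 'y"
      and sc :: "'k \<Rightarrow> 'z::ab_group_add \<Rightarrow> 'z" and f a b
  proof -
    have "Vector_Spaces.linear sb sc (f a)" "Vector_Spaces.linear sa sc (\<lambda>x. f x b)"
      using that by (auto simp: bilinear_map_def)
    then have "module_hom sb sc (f a)" "module_hom sa sc (\<lambda>x. f x b)"
      by (auto simp: module_hom_iff_linear)
    then show "f a 0 = 0" "f 0 b = 0"
      by (auto dest: module_hom.zero)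
  qed
  note zs = z[OF mult1_bilinear] z[OF mult2_bilinear] z[OF mu_bilinear] z[OF nu_bilinear]
    z[OF h_bilinear] z[OF theta_bilinear] z[OF brac1_bilinear] z[OF brac2_bilinear]
    z[OF rho_bilinear] z[OF psi_bilinear] z[OF H_bilinear] z[OF Theta_bilinear]
  show
    "mult1 x y = fst (odot (x, 0) (y, 0))" "h x y = snd (odot (x, 0) (y, 0))"
    "mult2 u v = snd (odot (0, u) (0, v))" "\<theta> u v = fst (odot (0, u) (0, v))"
    "\<nu> u y = fst (odot (0, u) (y, 0))" "\<mu> x v = snd (odot (x, 0) (0, v))"
    "brac1 x y = fst (brac (x, 0) (y, 0))" "H x y = snd (brac (x, 0) (y, 0))"
    "brac2 u v = snd (brac (0, u) (0, v))" "\<Theta> u v = fst (brac (0, u) (0, v))"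
    "\<psi> u y = fst (brac (0, u) (y, 0))" "\<rho> x v = snd (brac (x, 0) (0, v))"
    by (simp_all add: odot_eq brac_eq zs)
qed

lemma (in proto_twilled_poisson_algebra) structure_maps_exist:
  "proto_twilled_structure_maps s1 s2 odot brac
     (\<lambda>x y. fst (odot (x, 0) (y, 0))) (\<lambda>u v. snd (odot (0, u) (0, v)))
     (\<lambda>x v. snd (odot (x, 0) (0, v))) (\<lambda>u y. fst (odot (0, u) (y, 0)))
     (\<lambda>x y. snd (odot (x, 0) (y, 0))) (\<lambda>u v. fst (odot (0, u) (0, v)))
     (\<lambda>x y. fst (brac (x, 0) (y, 0))) (\<lambda>u v. snd (brac (0, u) (0, v)))
     (\<lambda>x v. snd (brac (x, 0) (0, v))) (\<lambda>u y. fst (brac (0, u) (y, 0)))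
     (\<lambda>x y. snd (brac (x, 0) (y, 0))) (\<lambda>u v. fst (brac (0, u) (0, v)))"
proof -
  let ?s = "module_prod.scale s1 s2"
  have lin: "Vector_Spaces.linear ?s ?s (f a)" "Vector_Spaces.linear ?s ?s (\<lambda>x. f x a)"
    if "f = odot \<or> f = brac" for f a
    using that P.mult_bilinear P.bracket_bilinear unfolding bilinear_map_def by blast+
  have i1: "Vector_Spaces.linear s1 ?s (\<lambda>x. (x, 0))" and i2: "Vector_Spaces.linear s2 ?s (Pair 0)"
    by (unfold_locales, auto simp: scale_def)+
  have p1: "Vector_Spaces.linear ?s s1 fst" and p2: "Vector_Spaces.linear ?s s2 snd"
    by (rule linear_fst linear_snd)+
  note c = Vector_Spaces.linear_compose[unfolded o_def]
  have bil:
    "bilinear_map s1 s1 s1 (\<lambda>x y. fst (f (x, 0) (y, 0)))"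
    "bilinear_map s1 s1 s2 (\<lambda>x y. snd (f (x, 0) (y, 0)))"
    "bilinear_map s2 s2 s1 (\<lambda>x y. fst (f (0, x) (0, y)))"
    "bilinear_map s2 s2 s2 (\<lambda>x y. snd (f (0, x) (0, y)))"
    "bilinear_map s1 s2 s2 (\<lambda>x y. snd (f (x, 0) (0, y)))"
    "bilinear_map s2 s1 s1 (\<lambda>x y. fst (f (0, x) (y, 0)))"
    if f: "f = odot \<or> f = brac" for f
    unfolding bilinear_map_def
    by (intro conjI allI c[OF c[OF i1 lin(1)[OF f]] p1] c[OF c[OF i1 lin(2)[OF f]] p1]
        c[OF c[OF i1 lin(1)[OF f]] p2] c[OF c[OF i1 lin(2)[OF f]] p2]
        c[OF c[OF i2 lin(1)[OF f]] p1] c[OF c[OF i2 lin(2)[OF f]] p1]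
        c[OF c[OF i2 lin(1)[OF f]] p2] c[OF c[OF i2 lin(2)[OF f]] p2])+
  have add: "f a (b + b') = f a b + f a b'" "f (a + a') b = f a b + f a' b"
    if "f = odot \<or> f = brac" for f a a' b b'
  proof -
    have "module_hom ?s ?s (f a)" "module_hom ?s ?s (\<lambda>x. f x b)"
      using lin[OF that] by (auto simp: module_hom_iff_linear)
    then show "f a (b + b') = f a b + f a b'" "f (a + a') b = f a b + f a' b"
      by (auto dest: module_hom.add)
  qed
  have anti: "brac a b = - brac b a" for a b
  proof -
    have "brac (a + b) (a + b) = 0" by (rule P.bracket_self)
    then have "brac a b + brac b a = 0"
      unfolding add[of brac, OF disjI2[OF refl]]
      by (simp add: P.bracket_self add.commute)
    then show ?thesis by (simp add: eq_neg_iff_add_eq_0)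
  qed
  have split: "(x, u) = (x, 0) + (0, u)" for x :: 'a and u :: 'b by simp
  have four: "f (x, u) (y, v) = f (x, 0) (y, 0) + f (x, 0) (0, v) + f (0, u) (y, 0) + f (0, u) (0, v)"
    if "f = odot \<or> f = brac" for f x u y v
    by (subst (1 2) split) (simp only: add[OF that] ac_simps)
  show ?thesis
  proof (unfold_locales, goal_cases)
    case (21 x u y v)
    show ?case using four[of odot x u y v] P.mult_commute[of "(x, 0)" "(0, v)"]
      P.mult_commute[of "(y, 0)" "(0, u)"]
      by (simp add: prod_eq_iff ac_simps)
  next
    case (22 x u y v)
    show ?case using four[of brac x u y v] anti[of "(x, 0)" "(0, v)"] anti[of "(y, 0)" "(0, u)"]
      by (simp add: prod_eq_iff algebra_simps)
  next
    case (2 x y) show ?case by (simp add: P.mult_commute)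
  next
    case (4 x y) show ?case by (simp add: P.mult_commute)
  next
    case (8 x y) show ?case by (simp add: P.mult_commute)
  next
    case (10 x y) show ?case by (simp add: P.mult_commute)
  next
    case (12 x y) show ?case by (subst anti) simp
  next
    case (14 x y) show ?case by (subst anti) simp
  next
    case (18 x y) show ?case by (subst anti) simp
  next
    case (20 x y) show ?case by (subst anti) simp
  qed (simp_all add: bil)
qed

definition Gr :: "('b \<Rightarrow> 'a) \<Rightarrow> ('a \<times> 'b) set" where
  "Gr r = {(r u, u) | u. True}"

definition deformation_map ::
    "('k::field \<Rightarrow> 'a::ab_group_add \<Rightarrow> 'a) \<Rightarrow> ('k \<Rightarrow> 'b::ab_group_add \<Rightarrow> 'b)
      \<Rightarrow> ('a \<times> 'b \<Rightarrow> 'a \<times> 'b \<Rightarrow> 'a \<times> 'b) \<Rightarrow> ('a \<times> 'b \<Rightarrow> 'a \<times> 'b \<Rightarrow> 'a \<times> 'b) \<Rightarrow> ('b \<Rightarrow> 'a) \<Rightarrow> bool" where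
  "deformation_map s1 s2 odot brac r \<longleftrightarrow>
     Vector_Spaces.linear s2 s1 r \<and>
     poisson_subalgebra (module_prod.scale s1 s2) odot brac (Gr r)"

definition induced_mult ::
    "('b::ab_group_add \<Rightarrow> 'b \<Rightarrow> 'b) \<Rightarrow> ('a \<Rightarrow> 'b \<Rightarrow> 'b) \<Rightarrow> ('a \<Rightarrow> 'a \<Rightarrow> 'b) \<Rightarrow> ('b \<Rightarrow> 'a) \<Rightarrow> 'b \<Rightarrow> 'b \<Rightarrow> 'b" where
  "induced_mult mult2 \<mu> h r u v = mult2 u v + \<mu> (r u) v + \<mu> (r v) u + h (r u) (r v)"

definition induced_bracket ::
    "('b::ab_group_add \<Rightarrow> 'b \<Rightarrow> 'b) \<Rightarrow> ('a \<Rightarrow> 'b \<Rightarrow> 'b) \<Rightarrow> ('a \<Rightarrow> 'a \<Rightarrow> 'b) \<Rightarrow> ('b \<Rightarrow> 'a) \<Rightarrow> 'b \<Rightarrow> 'b \<Rightarrow> 'b" where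
  "induced_bracket brac2 \<rho> H r u v = brac2 u v + \<rho> (r u) v - \<rho> (r v) u + H (r u) (r v)"

definition induced_nu ::
    "('a::ab_group_add \<Rightarrow> 'a \<Rightarrow> 'a) \<Rightarrow> ('a \<Rightarrow> 'b::ab_group_add \<Rightarrow> 'b) \<Rightarrow> ('b \<Rightarrow> 'a \<Rightarrow> 'a) \<Rightarrow> ('a \<Rightarrow> 'a \<Rightarrow> 'b)
      \<Rightarrow> ('b \<Rightarrow> 'a) \<Rightarrow> 'b \<Rightarrow> 'a \<Rightarrow> 'a" where
  "induced_nu mult1 \<mu> \<nu> h r u x = \<nu> u x + mult1 (r u) x - r (\<mu> x u + h (r u) x)"

definition induced_psi ::
    "('a::ab_group_add \<Rightarrow> 'a \<Rightarrow> 'a) \<Rightarrow> ('a \<Rightarrow> 'b::ab_group_add \<Rightarrow> 'b) \<Rightarrow> ('b \<Rightarrow> 'a \<Rightarrow> 'a) \<Rightarrow> ('a \<Rightarrow> 'a \<Rightarrow> 'b)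
      \<Rightarrow> ('b \<Rightarrow> 'a) \<Rightarrow> 'b \<Rightarrow> 'a \<Rightarrow> 'a" where
  "induced_psi brac1 \<rho> \<psi> H r u x = \<psi> u x + brac1 (r u) x - r (- \<rho> x u + H (r u) x)"

end

theory Submission
  imports Defs
begin

text \<open>
  The graph of \<open>r\<close> is a subalgebra complementary to \<open>P\<^sub>1\<close>, so it acts by left multiplication and by
  the adjoint action on the quotient of the whole algebra by the graph, which is \<open>P\<^sub>1\<close>. The graph is
  isomorphic to \<open>P\<^sub>2\<close> via \<open>u \<mapsto> (r u, u)\<close>; the operations transported along this isomorphism are
  \<open>\<cdot>\<^sub>r\<close> and \<open>{ , }\<^sub>r\<close>, and the projection \<open>(x, u) \<mapsto> x - r u\<close> along the graph turns the
  action into \<open>\<nu>\<^sub>r\<close> and \<open>\<psi>\<^sub>r\<close>.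
\<close>

text \<open>All operations and actions built below have this shape: inject both arguments, multiply
  or bracket, then project.\<close>

lemma bilinear_map_compose:
  assumes "bilinear_map s1 s2 s3 f" "Vector_Spaces.linear t1 s1 a"
    "Vector_Spaces.linear t2 s2 b" "Vector_Spaces.linear s3 t3 c"
  shows "bilinear_map t1 t2 t3 (\<lambda>x y. c (f (a x) (b y)))"
proof -
  note comp = Vector_Spaces.linear_compose[unfolded o_def]
  have "Vector_Spaces.linear s2 s3 (f x)" "Vector_Spaces.linear s1 s3 (\<lambda>x. f x y)" for x y
    using assms(1) by (auto simp: bilinear_map_def)
  then show ?thesis
    unfolding bilinear_map_def
    by (intro conjI allI comp[OF comp[OF assms(3)] assms(4)] comp[OF comp[OF assms(2)] assms(4)])
qed

context poisson_algebra
begin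

lemma mult_right: "Vector_Spaces.linear s s (mult x)"
  and mult_left: "Vector_Spaces.linear s s (\<lambda>x. mult x y)"
  using mult_bilinear by (auto simp: bilinear_map_def)

lemma bracket_right: "Vector_Spaces.linear s s (bracket x)"
  and bracket_left: "Vector_Spaces.linear s s (\<lambda>x. bracket x y)"
  using bracket_bilinear by (auto simp: bilinear_map_def)

lemmas mult_add_right = module_hom.add[OF mult_right[folded module_hom_iff_linear]]
  and bracket_add_right = module_hom.add[OF bracket_right[folded module_hom_iff_linear]]
  and bracket_add_left = module_hom.add[OF bracket_left[folded module_hom_iff_linear]]
  and bracket_minus_right = module_hom.neg[OF bracket_right[folded module_hom_iff_linear]]

lemma bracket_antisym: "bracket x y = - bracket y x"
proof -
  have "bracket (x + y) (x + y) = 0" by (rule bracket_self)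
  then have "bracket x y + bracket y x = 0"
    unfolding bracket_add_left bracket_add_right by (simp add: bracket_self add.commute)
  then show ?thesis by (simp add: eq_neg_iff_add_eq_0)
qed

text \<open>Jacobi in the form needed for \<open>rho_bracket\<close>: the adjoint action turns
  brackets into commutators.\<close>

lemma bracket_bracket_left:
  "bracket (bracket x y) z = bracket x (bracket y z) - bracket y (bracket x z)"
proof -
  have "bracket x (bracket y z) - bracket y (bracket x z) - bracket (bracket x y) z = 0"
    using jacobi[of x y z]
    unfolding bracket_antisym[of z x] bracket_antisym[of z "bracket x y"] bracket_minus_right
    by simp
  then show ?thesis by simp
qed

text \<open>Leibniz moved to the first argument by antisymmetry; this becomes
  \<open>rho_mult\<close>.\<close>

lemma bracket_mult_left:
  "bracket (mult x y) z = mult x (bracket y z) + mult y (bracket x z)"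
proof -
  have "bracket (mult x y) z = - (mult (bracket z x) y + mult x (bracket z y))"
    using bracket_antisym[of "mult x y" z] by (simp add: leibniz)
  then show ?thesis
    using bracket_antisym[of z x] bracket_antisym[of z y]
      module_hom.neg[OF mult_right[folded module_hom_iff_linear]]
    by (simp add: mult_commute[of _ y])
qed

end

text \<open>
  A Poisson algebra written as a biproduct of vector spaces \<open>W\<close> and \<open>V\<close>, with injections \<open>g\<close>, \<open>j\<close>
  and projections \<open>p\<close>, \<open>q\<close>, such that the image of \<open>W\<close> is a subalgebra.
\<close>

locale poisson_split_subalgebra =
  poisson_algebra s mult bracket
  for s :: "'k::field \<Rightarrow> 'p::ab_group_add \<Rightarrow> 'p"
    and mult bracket :: "'p \<Rightarrow> 'p \<Rightarrow> 'p" +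
  fixes sW :: "'k \<Rightarrow> 'w::ab_group_add \<Rightarrow> 'w"
    and sV :: "'k \<Rightarrow> 'v::ab_group_add \<Rightarrow> 'v"
    and g :: "'w \<Rightarrow> 'p" and p :: "'p \<Rightarrow> 'w"
    and j :: "'v \<Rightarrow> 'p" and q :: "'p \<Rightarrow> 'v"
  assumes g_linear: "Vector_Spaces.linear sW s g"
    and p_linear: "Vector_Spaces.linear s sW p"
    and j_linear: "Vector_Spaces.linear sV s j"
    and q_linear: "Vector_Spaces.linear s sV q"
    and p_g: "p (g u) = u"
    and q_g: "q (g u) = 0"
    and decomp: "z = g (p z) + j (q z)"
    and mult_closed: "mult (g u) (g v) \<in> range g"
    and bracket_closed: "bracket (g u) (g v) \<in> range g"
begin

text \<open>\<open>g\<close> after \<open>p\<close> fixes the range of \<open>g\<close>, and closure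
  puts the product there.\<close>

lemma g_mult: "g (p (mult (g u) (g v))) = mult (g u) (g v)"
  using mult_closed[of u v] by (auto simp: p_g)

lemma g_bracket: "g (p (bracket (g u) (g v))) = bracket (g u) (g v)"
  using bracket_closed[of u v] by (auto simp: p_g)

lemmas p_add = module_hom.add[OF p_linear[folded module_hom_iff_linear]]
  and p_zero = module_hom.zero[OF p_linear[folded module_hom_iff_linear]]
  and q_add = module_hom.add[OF q_linear[folded module_hom_iff_linear]]
  and q_diff = module_hom.diff[OF q_linear[folded module_hom_iff_linear]]

text \<open>The actions on \<open>V\<close> are those on the quotient by the image of \<open>W\<close>.\<close>

lemma q_mult: "q (mult (g u) (j (q z))) = q (mult (g u) z)"
proof -
  have "q (mult (g u) z) = q (mult (g u) (g (p z)) + mult (g u) (j (q z)))"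
    by (subst decomp[of z]) (simp only: mult_add_right)
  \<comment> \<open>Rewritten by \<open>g_mult\<close>, this instance says that \<open>q\<close>
    kills \<open>mult (g u) (g (p z))\<close>.\<close>
  then show ?thesis using q_g[of "p (mult (g u) (g (p z)))"] by (simp add: q_add g_mult)
qed

lemma q_bracket: "q (bracket (g u) (j (q z))) = q (bracket (g u) z)"
proof -
  have "q (bracket (g u) z) = q (bracket (g u) (g (p z)) + bracket (g u) (j (q z)))"
    by (subst decomp[of z]) (simp only: bracket_add_right)
  then show ?thesis using q_g[of "p (bracket (g u) (g (p z)))"] by (simp add: q_add g_bracket)
qed

text \<open>Once the inner projections are erased, each algebraic law is the image under
  \<open>p\<close> or \<open>q\<close> of an identity of the ambient algebra.\<close>

lemma quotient_representation:
  "poisson_representation sW (\<lambda>u v. p (mult (g u) (g v))) (\<lambda>u v. p (bracket (g u) (g v)))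
     sV (\<lambda>u x. q (mult (g u) (j x))) (\<lambda>u x. q (bracket (g u) (j x)))"
proof -
  interpret W: vector_space sW using g_linear by (simp add: Vector_Spaces.linear_def)
  interpret V: vector_space sV using j_linear by (simp add: Vector_Spaces.linear_def)
  show ?thesis
  proof
    show "p (mult (g u) (g v)) = p (mult (g v) (g u))" for u v
      by (simp only: mult_commute)
    show "bilinear_map sW sW sW (\<lambda>u v. p (mult (g u) (g v)))"
      by (rule bilinear_map_compose[OF mult_bilinear g_linear g_linear p_linear])
    show "bilinear_map sW sW sW (\<lambda>u v. p (bracket (g u) (g v)))"
      by (rule bilinear_map_compose[OF bracket_bilinear g_linear g_linear p_linear])
    show "bilinear_map sW sV sV (\<lambda>u x. q (mult (g u) (j x)))"
      by (rule bilinear_map_compose[OF mult_bilinear g_linear j_linear q_linear])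
    show "bilinear_map sW sV sV (\<lambda>u x. q (bracket (g u) (j x)))"
      by (rule bilinear_map_compose[OF bracket_bilinear g_linear j_linear q_linear])
  qed (simp_all add: g_mult g_bracket q_mult q_bracket mult_assoc bracket_self p_zero
      bracket_bracket_left bracket_mult_left leibniz
      flip: p_add q_add q_diff add: jacobi)
qed

end

theorem proposition6p2:
  fixes s1 :: "'k::field_char_0 \<Rightarrow> 'a::ab_group_add \<Rightarrow> 'a"
    and s2 :: "'k \<Rightarrow> 'b::ab_group_add \<Rightarrow> 'b"
    and odot brac :: "'a \<times> 'b \<Rightarrow> 'a \<times> 'b \<Rightarrow> 'a \<times> 'b"
    and mult1 :: "'a \<Rightarrow> 'a \<Rightarrow> 'a" and mult2 :: "'b \<Rightarrow> 'b \<Rightarrow> 'b"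
    and \<mu> :: "'a \<Rightarrow> 'b \<Rightarrow> 'b" and \<nu> :: "'b \<Rightarrow> 'a \<Rightarrow> 'a"
    and h :: "'a \<Rightarrow> 'a \<Rightarrow> 'b" and \<theta> :: "'b \<Rightarrow> 'b \<Rightarrow> 'a"
    and brac1 :: "'a \<Rightarrow> 'a \<Rightarrow> 'a" and brac2 :: "'b \<Rightarrow> 'b \<Rightarrow> 'b"
    and \<rho> :: "'a \<Rightarrow> 'b \<Rightarrow> 'b" and \<psi> :: "'b \<Rightarrow> 'a \<Rightarrow> 'a"
    and H :: "'a \<Rightarrow> 'a \<Rightarrow> 'b" and \<Theta> :: "'b \<Rightarrow> 'b \<Rightarrow> 'a"
    and r :: "'b \<Rightarrow> 'a"
  assumes "proto_twilled_poisson_algebra s1 s2 odot brac"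
    and "proto_twilled_structure_maps s1 s2 odot brac mult1 mult2 \<mu> \<nu> h \<theta> brac1 brac2 \<rho> \<psi> H \<Theta>"
    and "deformation_map s1 s2 odot brac r"
  shows "poisson_representation
           s2 (induced_mult mult2 \<mu> h r) (induced_bracket brac2 \<rho> H r)
           s1 (induced_nu mult1 \<mu> \<nu> h r) (induced_psi brac1 \<rho> \<psi> H r)"
proof -
  interpret proto_twilled_structure_maps s1 s2 odot brac mult1 mult2 \<mu> \<nu> h \<theta> brac1 brac2 \<rho> \<psi> H \<Theta>
    by fact
  have r: "Vector_Spaces.linear s2 s1 r"
    and sub: "poisson_subalgebra scale odot brac (Gr r)"
    using assms(3) by (auto simp: deformation_map_def)
  interpret r: Vector_Spaces.linear s2 s1 r by (fact r)
  have Gr: "Gr r = range (\<lambda>u. (r u, u))" by (auto simp: Gr_def)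
  have zero: "f a 0 = 0" "f 0 b = 0" if "bilinear_map sa sb sc f"
    for sa :: "'k \<Rightarrow> 'x::ab_group_add \<Rightarrow> 'x" and sb :: "'k \<Rightarrow> 'y::ab_group_add \<Rightarrow> 'y"
      and sc :: "'k \<Rightarrow> 'z::ab_group_add \<Rightarrow> 'z" and f a b
    using that unfolding bilinear_map_def module_hom_iff_linear[symmetric]
    by (auto dest: module_hom.zero)
  \<comment> \<open>In the action of \<open>(r u, u)\<close> on \<open>(x, 0)\<close>, the terms
    containing the zero of \<open>P\<^sub>2\<close> vanish.\<close>
  note zeros = zero[OF mult2_bilinear] zero[OF mu_bilinear] zero[OF nu_bilinear]
    zero[OF theta_bilinear] zero[OF brac2_bilinear] zero[OF rho_bilinear] zero[OF psi_bilinear]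
    zero[OF Theta_bilinear]
  \<comment> \<open>The splitting is \<open>(x, u) = (r u, u) + (x - r u, 0)\<close>.\<close>
  interpret S: poisson_split_subalgebra scale odot brac s2 s1 "\<lambda>u. (r u, u)" snd "\<lambda>x. (x, 0)"
    "\<lambda>z. fst z - r (snd z)"
  proof
    fix u v
    show "odot (r u, u) (r v, v) \<in> range (\<lambda>u. (r u, u))"
      and "brac (r u, u) (r v, v) \<in> range (\<lambda>u. (r u, u))"
      using sub unfolding poisson_subalgebra_def Gr by blast+
  qed (auto simp: scale_def r.add r.scale module.scale_right_diff_distrib[OF module_hom.axioms(2)[OF r.module_hom_axioms]])
  \<comment> \<open>\<open>odot (r u, u) (x, 0)\<close> has components
    \<open>mult1 (r u) x + \<nu> u x\<close> and \<open>\<mu> x u + h (r u) x\<close>; the first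
    minus \<open>r\<close> of the second is \<open>induced_nu\<close>. Likewise \<open>brac\<close>
    gives \<open>induced_psi\<close>.\<close>
  show ?thesis
    using S.quotient_representation
    by (simp add: odot_eq brac_eq zeros induced_mult_def[abs_def] induced_bracket_def[abs_def]
        induced_nu_def[abs_def] induced_psi_def[abs_def] add.commute)
qed

end
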